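(* Let $A\in\mathbb{R}^{n\times n}$, $C=I\in\mathbb{R}^{n\times n}$, $N\ge1$, let $L=W_o$ be the observability Gramian over horizon $N$, and let $Y\sim\mathcal{P}_L$ be the random subset of selected nodes in $\mathcal{Y}=\{1,\dots,n\}$. Then the complement $\bar Y:=\mathcal{Y}\setminus Y$ is itself a determinantal point process with marginal kernel $I-K$, where $K=W_o(W_o+I)^{-1}$. That is, $$\mathbb{P}(\bar Y\supseteq S)=\det\big((I-K)_S\big)\qquad\text{for all }S\subseteq\mathcal{Y}.$$ The diagonal entry $(I-K)_{ii}=1-K_{ii}$ is the probability that node $i$ is excluded from the selected set $Y$.
   Context: For $x[k+1]=Ax[k]+Bu[k]$, $y[k]=Cx[k]$, the observability Gramian over horizon $N$ is $W_o=\sum_{k=0}^{N-1}(A^k)^\top C^\top CA^k\in\mathbb{R}^{n\times n}$. For a matrix $M$ and an index set $S$, $M_S=[M_{ij}]_{i,j\in S}$ is the principal submatrix, with $\det(M_\emptyset)=1$. For symmetric $L\succeq0$ indexed by $\mathcal{Y}$, the L-ensemble determinantal point process is the probability measure $\mathcal{P}_L(Y)=\det(L_Y)/\det(L+I)$ on $2^{\mathcal{Y}}$. A random subset $Z\subseteq\mathcal{Y}$ is a determinantal point process with marginal kernel $M$ if $\mathbb{P}(S\subseteq Z)=\det(M_S)$ for all $S\subseteq\mathcal{Y}$. *)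

theory Defs
  imports
    "HOL-Probability.Probability_Measure"
    "Jordan_Normal_Form.DL_Submatrix"
    "Jordan_Normal_Form.Gauss_Jordan_Elimination"
    "Jordan_Normal_Form.Determinant"
begin

text \<open>
  An index set \<open>{1,\<dots>,n}\<close> is represented by \<open>{..<n}\<close>, the indices of an
  \<open>n \<times> n\<close> matrix. Some names are qualified because the theories on Euclidean
  spaces also have a \<open>mat\<close> and a \<open>det\<close>.
\<close>

definition obs_gramian :: "real mat \<Rightarrow> real mat \<Rightarrow> nat \<Rightarrow> real mat" where
  "obs_gramian A C N = Matrix.mat (dim_row A) (dim_row A) (\<lambda>(i, j).
     \<Sum>k<N. (transpose_mat (A ^\<^sub>m k) * transpose_mat C * C * (A ^\<^sub>m k)) $$ (i, j))"

text \<open>For \<open>S = {}\<close> this is the determinant of the \<open>0 \<times> 0\<close> matrix, which is 1.\<close>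

definition principal_minor :: "real mat \<Rightarrow> nat set \<Rightarrow> real" where
  "principal_minor M S = Determinant.det (submatrix M S S)"

text \<open>
  The conversion to \<open>ennreal\<close> sends negative reals to 0. It has no effect if \<open>L\<close> is
  symmetric positive semidefinite, since all principal minors are then nonnegative.
\<close>

definition L_ensemble :: "real mat \<Rightarrow> nat set measure" where
  "L_ensemble L = point_measure (Pow {..<dim_row L})
     (\<lambda>Y. ennreal (principal_minor L Y / Determinant.det (L + 1\<^sub>m (dim_row L))))"

definition random_subset :: "'w measure \<Rightarrow> nat \<Rightarrow> ('w \<Rightarrow> nat set) \<Rightarrow> bool" where
  "random_subset P n Z \<longleftrightarrow> prob_space P \<and> Z \<in> measurable P (count_space (Pow {..<n}))"

definition is_L_ensemble :: "'w measure \<Rightarrow> ('w \<Rightarrow> nat set) \<Rightarrow> real mat \<Rightarrow> bool" where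
  "is_L_ensemble P Y L \<longleftrightarrow> random_subset P (dim_row L) Y \<and>
     distr P (count_space (Pow {..<dim_row L})) Y = L_ensemble L"

definition is_DPP :: "'w measure \<Rightarrow> ('w \<Rightarrow> nat set) \<Rightarrow> real mat \<Rightarrow> bool" where
  "is_DPP P Z M \<longleftrightarrow> random_subset P (dim_row M) Z \<and>
     (\<forall>S \<subseteq> {..<dim_row M}. measure P {\<omega> \<in> space P. S \<subseteq> Z \<omega>} = principal_minor M S)"

text \<open>
  \<open>mat_inverse\<close> is \<open>None\<close> on singular matrices. \<open>L + I\<close> is positive definite, hence
  invertible, for symmetric positive semidefinite \<open>L\<close>.
\<close>

definition marginal_kernel :: "real mat \<Rightarrow> real mat" where
  "marginal_kernel L = L * the (mat_inverse (L + 1\<^sub>m (dim_row L)))"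

end

theory Submission
  imports Defs
begin

text \<open>
  Replace the rows of a matrix \<open>M\<close> outside of an index set \<open>T\<close> by those of the identity; the
  determinant of the resulting matrix is the principal minor of \<open>M\<close> on \<open>T\<close>. Multilinearity in
  the rows then gives \<open>det ((L + I)\<^sub>T) = (\<Sum>Z \<subseteq> T. det (L\<^sub>Z))\<close>, and multiplying the matrix
  obtained from \<open>(L + I)\<inverse>\<close> and \<open>S\<close> by \<open>L + I\<close> gives the one obtained from \<open>L + I\<close> and the
  complement of \<open>S\<close>, which is Jacobi's identity for complementary minors. As \<open>I - K = (L + I)\<inverse>\<close>, both
  sides of the claim equal \<open>det ((L + I)\<^sub>T) / det (L + I)\<close> where \<open>T\<close> is the complement of \<open>S\<close>.
\<close>

section \<open>Leibniz sums over arbitrary finite index sets\<close>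

text \<open>The determinant of a matrix indexed by a finite set \<open>T\<close>. Keeping the
  original indices, where \<open>submatrix\<close> renumbers them, makes minors on different subsets
  directly comparable.\<close>

definition leibniz :: "('a \<Rightarrow> 'a \<Rightarrow> 'b :: comm_ring_1) \<Rightarrow> 'a set \<Rightarrow> 'b" where
  "leibniz f T = (\<Sum>p | p permutes T. of_int (sign p) * (\<Prod>i\<in>T. f i (p i)))"

lemma prod_of_bool:
  "finite A \<Longrightarrow> (\<Prod>i\<in>A. of_bool (P i)) = (of_bool (\<forall>i\<in>A. P i) :: 'b :: comm_semiring_1)"
  by (induction A rule: finite_induct) auto

text \<open>The product over \<open>T - Z\<close> is 1 if \<open>p\<close> fixes
  \<open>T - Z\<close> pointwise and 0 otherwise, and the permutations of \<open>T\<close> that fix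
  \<open>T - Z\<close> are exactly those of \<open>Z\<close>. The left side is the Leibniz expansion
  of a matrix whose rows outside \<open>Z\<close> are identity rows.\<close>

lemma leibniz_identity_rows:
  fixes f :: "'a \<Rightarrow> 'a \<Rightarrow> 'b :: comm_ring_1"
  assumes "finite T" "Z \<subseteq> T"
  shows "(\<Sum>p | p permutes T. of_int (sign p) *
            ((\<Prod>i\<in>Z. f i (p i)) * (\<Prod>i\<in>T - Z. of_bool (i = p i)))) = leibniz f Z"
  unfolding leibniz_def
proof (rule sum.mono_neutral_cong_right)
  show "finite {p. p permutes T}"
    using assms(1) by (rule finite_permutations)
  show "{p. p permutes Z} \<subseteq> {p. p permutes T}"
    using assms(2) by (auto intro: permutes_subset)
  have fin: "finite (T - Z)"
    using assms(1) by simp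
  show "\<forall>p\<in>{p. p permutes T} - {p. p permutes Z}. of_int (sign p) *
          ((\<Prod>i\<in>Z. f i (p i)) * (\<Prod>i\<in>T - Z. of_bool (i = p i))) = 0"
  proof
    fix p assume p: "p \<in> {p. p permutes T} - {p. p permutes Z}"
    then have "\<not> (\<forall>i\<in>T - Z. p i = i)"
      using permutes_superset[of p T Z] by blast
    then have "\<not> (\<forall>i\<in>T - Z. i = p i)"
      by metis
    then show "of_int (sign p) *
          ((\<Prod>i\<in>Z. f i (p i)) * (\<Prod>i\<in>T - Z. of_bool (i = p i))) = 0"
      by (simp only: prod_of_bool[OF fin] of_bool_eq mult_zero_right simp_thms)
  qed
  fix p assume "p \<in> {p. p permutes Z}"
  then have "(\<forall>i\<in>T - Z. i = p i) = True"
    by (auto simp: permutes_def)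
  then show "of_int (sign p) *
          ((\<Prod>i\<in>Z. f i (p i)) * (\<Prod>i\<in>T - Z. of_bool (i = p i)))
        = of_int (sign p) * (\<Prod>i\<in>Z. f i (p i))"
    by (simp only: prod_of_bool[OF fin] of_bool_eq mult_1_right)
qed

text \<open>Expand each product of sums: \<open>Z\<close> collects the rows in which the summand
  from \<open>f\<close> is chosen, and the remaining rows are identity rows.\<close>

lemma leibniz_add_identity:
  fixes f :: "'a \<Rightarrow> 'a \<Rightarrow> 'b :: comm_ring_1"
  assumes "finite T"
  shows "leibniz (\<lambda>i j. f i j + of_bool (i = j)) T = (\<Sum>Z\<in>Pow T. leibniz f Z)"
proof -
  have "leibniz (\<lambda>i j. f i j + of_bool (i = j)) T = (\<Sum>p | p permutes T. \<Sum>Z\<in>Pow T.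
      of_int (sign p) * ((\<Prod>i\<in>Z. f i (p i)) * (\<Prod>i\<in>T - Z. of_bool (i = p i))))"
    by (simp only: leibniz_def prod_add[OF assms] sum_distrib_left)
  also have "\<dots> = (\<Sum>Z\<in>Pow T. \<Sum>p | p permutes T.
      of_int (sign p) * ((\<Prod>i\<in>Z. f i (p i)) * (\<Prod>i\<in>T - Z. of_bool (i = p i))))"
    by (rule sum.swap)
  also have "\<dots> = (\<Sum>Z\<in>Pow T. leibniz f Z)"
    using assms by (intro sum.cong leibniz_identity_rows) auto
  finally show ?thesis .
qed

text \<open>Transporting permutations along \<open>g\<close> is a bijection from those of
  \<open>S\<close> to those of \<open>T\<close>. It preserves the sign and, after renaming the
  index, the product.\<close>

lemma leibniz_reindex:
  fixes f :: "'a \<Rightarrow> 'a \<Rightarrow> 'b :: comm_ring_1"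
  assumes g: "bij_betw g S T" and S: "finite S"
  shows "leibniz (\<lambda>i j. f (g i) (g j)) S = leibniz f T"
  unfolding leibniz_def
proof (rule sum.reindex_bij_witness[where
      i = "map_permutation T (inv_into S g)" and j = "map_permutation S g"])
  have inj: "inj_on g S"
    using g by (rule bij_betw_imp_inj_on)
  fix p assume "p \<in> {p. p permutes S}"
  then have p: "p permutes S" by simp
  show "map_permutation T (inv_into S g) (map_permutation S g p) = p"
    using g p by (rule map_permutation_compose_inv) (simp add: inj)
  show "map_permutation S g p \<in> {p. p permutes T}"
    using map_permutation_permutes[OF g p] by simp
  have "(\<Prod>i\<in>T. f i (map_permutation S g p i)) = (\<Prod>i\<in>S. f (g i) (map_permutation S g p (g i)))"
    using g by (rule prod.reindex_bij_betw[symmetric])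
  also have "\<dots> = (\<Prod>i\<in>S. f (g i) (g (p i)))"
    using inj by (intro prod.cong) (simp_all add: map_permutation_apply)
  finally show "of_int (sign (map_permutation S g p)) * (\<Prod>i\<in>T. f i (map_permutation S g p i))
      = of_int (sign p) * (\<Prod>i\<in>S. f (g i) (g (p i)))"
    by (simp add: sign_map_permutation[OF inj p S])
next
  have g': "bij_betw (inv_into S g) T S"
    using g by (rule bij_betw_inv_into)
  fix p assume "p \<in> {p. p permutes T}"
  then have p: "p permutes T" by simp
  show "map_permutation S g (map_permutation T (inv_into S g) p) = p"
    using g' p by (rule map_permutation_compose_inv) (simp add: bij_betw_inv_into_right[OF g])
  show "map_permutation T (inv_into S g) p \<in> {p. p permutes S}"
    using map_permutation_permutes[OF g' p] by simp
qed

section \<open>Principal minors as Leibniz sums\<close>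

text \<open>\<open>pick I\<close> enumerates \<open>I\<close> in increasing order, so it is
  injective; comparing cardinalities gives surjectivity.\<close>

lemma bij_betw_pick:
  assumes "finite I"
  shows "bij_betw (pick I) {0..<card I} I"
proof (rule bij_betw_imageI)
  show "inj_on (pick I) {0..<card I}"
    by (intro linorder_inj_onI) (auto dest!: pick_mono[OF disjI1, THEN less_imp_neq])
  then have "card (pick I ` {0..<card I}) = card I"
    by (simp add: card_image)
  moreover have "pick I ` {0..<card I} \<subseteq> I"
    by (auto intro: pick_in_set)
  ultimately show "pick I ` {0..<card I} = I"
    using assms by (simp add: card_subset_eq)
qed

text \<open>The entries of \<open>submatrix M T T\<close> are those of \<open>M\<close> at positions
  renumbered by \<open>pick T\<close>; reindexing along this bijection undoes the
  renumbering.\<close>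

lemma principal_minor_eq_leibniz:
  assumes M: "M \<in> carrier_mat n n" and T: "T \<subseteq> {..<n}"
  shows "principal_minor M T = leibniz (\<lambda>i j. M $$ (i, j)) T"
proof -
  let ?k = "card T"
  have T': "{i. i < n \<and> i \<in> T} = T"
    using T by auto
  have fin: "finite T"
    using T by (rule finite_subset) simp
  have dims: "dim_row M = n" "dim_col M = n"
    using M by auto
  have entry: "submatrix M T T $$ (i, j) = M $$ (pick T i, pick T j)"
    if "i < ?k" "j < ?k" for i j
    using that by (intro submatrix_index) (simp_all add: dims T')
  have "submatrix M T T \<in> carrier_mat ?k ?k"
    by (intro carrier_matI) (simp_all add: dim_submatrix dims T')
  then have "principal_minor M T = leibniz (\<lambda>i j. submatrix M T T $$ (i, j)) {0..<?k}"
    unfolding principal_minor_def leibniz_def by (rule det_def')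
  also have "\<dots> = leibniz (\<lambda>i j. M $$ (pick T i, pick T j)) {0..<?k}"
    unfolding leibniz_def
    by (intro sum.cong arg_cong2[where f = "(*)"] prod.cong refl entry)
      (auto dest: permutes_in_image)
  also have "\<dots> = leibniz (\<lambda>i j. M $$ (i, j)) T"
    using bij_betw_pick[OF fin] by (rule leibniz_reindex) simp
  finally show ?thesis .
qed

lemma principal_minor_add_one:
  assumes L: "L \<in> carrier_mat n n" and T: "T \<subseteq> {..<n}"
  shows "principal_minor (L + 1\<^sub>m n) T = (\<Sum>Z\<in>Pow T. principal_minor L Z)"
proof -
  have fin: "finite T"
    using T by (rule finite_subset) simp
  have "principal_minor (L + 1\<^sub>m n) T = leibniz (\<lambda>i j. (L + 1\<^sub>m n) $$ (i, j)) T"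
    using L T by (intro principal_minor_eq_leibniz) auto
  also have "\<dots> = leibniz (\<lambda>i j. L $$ (i, j) + of_bool (i = j)) T"
    unfolding leibniz_def
  proof (intro sum.cong arg_cong2[where f = "(*)"] prod.cong refl)
    fix p i assume "p \<in> {p. p permutes T}" "i \<in> T"
    then have "i < n" "p i < n"
      using T permutes_in_image[of p T i] by auto
    then show "(L + 1\<^sub>m n) $$ (i, p i) = L $$ (i, p i) + of_bool (i = p i)"
      using L by simp
  qed
  also have "\<dots> = (\<Sum>Z\<in>Pow T. leibniz (\<lambda>i j. L $$ (i, j)) Z)"
    using fin by (rule leibniz_add_identity)
  also have "\<dots> = (\<Sum>Z\<in>Pow T. principal_minor L Z)"
    using T by (intro sum.cong principal_minor_eq_leibniz[OF L, symmetric]) auto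
  finally show ?thesis .
qed

lemma principal_minor_full:
  assumes "M \<in> carrier_mat n n"
  shows "principal_minor M {..<n} = Determinant.det M"
  using principal_minor_eq_leibniz[OF assms order_refl] det_def'[OF assms]
  by (simp add: leibniz_def atLeast0LessThan)

lemma principal_minor_singleton:
  assumes "M \<in> carrier_mat n n" "i < n"
  shows "principal_minor M {i} = M $$ (i, i)"
  using assms by (subst principal_minor_eq_leibniz[of M n]) (auto simp: leibniz_def)

section \<open>Row replacement and complementary minors\<close>

definition select_rows :: "real mat \<Rightarrow> nat set \<Rightarrow> real mat" where
  "select_rows M T = Matrix.mat (dim_row M) (dim_row M)
     (\<lambda>(i, j). if i \<in> T then M $$ (i, j) else of_bool (i = j))"

lemma det_select_rows:
  assumes M: "M \<in> carrier_mat n n" and T: "T \<subseteq> {..<n}"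
  shows "Determinant.det (select_rows M T) = principal_minor M T"
proof -
  have carr: "select_rows M T \<in> carrier_mat n n"
    using M by (simp add: select_rows_def)
  have prods: "(\<Prod>i = 0..<n. select_rows M T $$ (i, p i))
      = (\<Prod>i\<in>T. M $$ (i, p i)) * (\<Prod>i\<in>{0..<n} - T. of_bool (i = p i))"
    if p: "p permutes {0..<n}" for p
  proof -
    have "(\<Prod>i = 0..<n. select_rows M T $$ (i, p i))
        = (\<Prod>i = 0..<n. if i \<in> T then M $$ (i, p i) else of_bool (i = p i))"
      using M permutes_in_image[OF p] by (intro prod.cong) (auto simp: select_rows_def)
    also have "\<dots> = (\<Prod>i\<in>{0..<n} \<inter> T. M $$ (i, p i)) * (\<Prod>i\<in>{0..<n} - T. of_bool (i = p i))"
      by (simp add: prod.If_cases Diff_eq)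
    also have "{0..<n} \<inter> T = T"
      using T by auto
    finally show ?thesis .
  qed
  have "Determinant.det (select_rows M T) = (\<Sum>p | p permutes {0..<n}. of_int (sign p) *
      ((\<Prod>i\<in>T. M $$ (i, p i)) * (\<Prod>i\<in>{0..<n} - T. of_bool (i = p i))))"
    by (simp add: det_def'[OF carr] prods)
  also have "\<dots> = leibniz (\<lambda>i j. M $$ (i, j)) T"
    using T by (intro leibniz_identity_rows) auto
  finally show ?thesis
    using principal_minor_eq_leibniz[OF M T] by simp
qed

lemma jacobi_complementary_minor:
  assumes M: "M \<in> carrier_mat n n" and B: "B \<in> carrier_mat n n"
    and inv: "B * M = 1\<^sub>m n" and S: "S \<subseteq> {..<n}"
  shows "principal_minor B S * Determinant.det M = principal_minor M ({..<n} - S)"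
proof -
  have carr: "select_rows B S \<in> carrier_mat n n"
    using B by (simp add: select_rows_def)
  have "select_rows B S * M = select_rows M ({..<n} - S)"
  proof (rule eq_matI)
    fix i j
    assume "i < dim_row (select_rows M ({..<n} - S))" "j < dim_col (select_rows M ({..<n} - S))"
    then have i: "i < n" and j: "j < n"
      using M by (auto simp: select_rows_def)
    \<comment> \<open>Rows in \<open>S\<close> turn into rows of \<open>B * M\<close>, which is the
      identity; a unit vector in any other row extracts the corresponding row of
      \<open>M\<close>.\<close>
    have "row (select_rows B S) i = (if i \<in> S then row B i else unit_vec n i)"
      using B i by (intro eq_vecI) (auto simp: select_rows_def)
    then have "(select_rows B S * M) $$ (i, j)
        = (if i \<in> S then row B i \<bullet> col M j else unit_vec n i \<bullet> col M j)"
      using carr M i j by simp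
    also have "row B i \<bullet> col M j = (B * M) $$ (i, j)"
      using B M i j by simp
    also have "\<dots> = of_bool (i = j)"
      using i j by (simp add: inv)
    also have "unit_vec n i \<bullet> col M j = M $$ (i, j)"
      using M i j by (simp add: scalar_prod_left_unit[of _ n])
    finally show "(select_rows B S * M) $$ (i, j) = select_rows M ({..<n} - S) $$ (i, j)"
      using M i j by (auto simp: select_rows_def)
  qed (use carr M in \<open>auto simp: select_rows_def\<close>)
  then show ?thesis
    using det_mult[OF carr M] det_select_rows[OF B S] det_select_rows[OF M, of "{..<n} - S"]
    by simp
qed

section \<open>Normalization and probabilities of the L-ensemble\<close>

lemma sum_principal_minors:
  assumes "L \<in> carrier_mat n n"
  shows "(\<Sum>Z\<in>Pow {..<n}. principal_minor L Z) = Determinant.det (L + 1\<^sub>m n)"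
  using assms principal_minor_add_one[OF assms order_refl] principal_minor_full[of "L + 1\<^sub>m n" n]
  by simp

lemma emeasure_L_ensemble:
  assumes "L \<in> carrier_mat n n" "\<A> \<subseteq> Pow {..<n}"
  shows "emeasure (L_ensemble L) \<A>
    = (\<Sum>Z\<in>\<A>. ennreal (principal_minor L Z / Determinant.det (L + 1\<^sub>m n)))"
  using assms unfolding L_ensemble_def
  by (subst emeasure_point_measure_finite) auto

text \<open>
  The weights sum up to 1 before their conversion to \<open>ennreal\<close>. Since truncating negative weights
  would increase the sum, the total mass can only be 1 if there are none.
\<close>

lemma prob_space_L_ensemble_weights:
  assumes L: "L \<in> carrier_mat n n" and prob: "prob_space (L_ensemble L)"
  shows "Determinant.det (L + 1\<^sub>m n) \<noteq> 0"
    and "Z \<subseteq> {..<n} \<Longrightarrow> 0 \<le> principal_minor L Z / Determinant.det (L + 1\<^sub>m n)"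
proof -
  let ?D = "Determinant.det (L + 1\<^sub>m n)"
  let ?q = "\<lambda>Z. principal_minor L Z / ?D"
  have "ennreal (\<Sum>Z\<in>Pow {..<n}. max 0 (?q Z)) = (\<Sum>Z\<in>Pow {..<n}. ennreal (?q Z))"
    by (subst sum_ennreal[symmetric]) (auto simp: ennreal_max_0)
  also have "\<dots> = emeasure (L_ensemble L) (space (L_ensemble L))"
    using L by (subst emeasure_L_ensemble) (auto simp: L_ensemble_def space_point_measure)
  also have "\<dots> = 1"
    using prob by (rule prob_space.emeasure_space_1)
  finally have mass: "(\<Sum>Z\<in>Pow {..<n}. max 0 (?q Z)) = 1"
    by simp
  \<comment> \<open>Division by 0 yields 0, so a vanishing determinant would make every weight 0 and
    the total mass 0.\<close>
  then show D: "?D \<noteq> 0"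
    by auto
  have "(\<Sum>Z\<in>Pow {..<n}. ?q Z) = 1"
    using D sum_principal_minors[OF L] by (simp add: sum_divide_distrib[symmetric])
  with mass have "(\<Sum>Z\<in>Pow {..<n}. max 0 (?q Z) - ?q Z) = 0"
    by (simp only: sum_subtractf)
  then have eq: "\<forall>Z\<in>Pow {..<n}. max 0 (?q Z) - ?q Z = 0"
    by (subst (asm) sum_nonneg_eq_0_iff) auto
  assume "Z \<subseteq> {..<n}"
  then have "max 0 (?q Z) - ?q Z = 0"
    using eq by blast
  then show "0 \<le> ?q Z"
    by linarith
qed

text \<open>The event has probability equal to the sum of the weights of all subsets of
  \<open>T\<close>, and the minors in the numerators add up to one minor of
  \<open>L + I\<close>.\<close>

lemma L_ensemble_subset_prob:
  assumes L: "L \<in> carrier_mat n n" and Y: "is_L_ensemble P Y L" and T: "T \<subseteq> {..<n}"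
  shows "Determinant.det (L + 1\<^sub>m n) \<noteq> 0"
    and "measure P {\<omega> \<in> space P. Y \<omega> \<subseteq> T}
      = principal_minor (L + 1\<^sub>m n) T / Determinant.det (L + 1\<^sub>m n)"
proof -
  let ?D = "Determinant.det (L + 1\<^sub>m n)"
  let ?q = "\<lambda>Z. principal_minor L Z / ?D"
  have P: "prob_space P" and meas: "Y \<in> measurable P (count_space (Pow {..<n}))"
    and distr: "distr P (count_space (Pow {..<n})) Y = L_ensemble L"
    using L Y by (auto simp: is_L_ensemble_def random_subset_def)
  \<comment> \<open>As the law of \<open>Y\<close>, the measure \<open>L_ensemble L\<close> has
    total mass 1; this yields the nonzero determinant and the nonnegative weights.\<close>
  have prob: "prob_space (L_ensemble L)"
    using prob_space.prob_space_distr[OF P meas] by (simp add: distr)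
  show "?D \<noteq> 0"
    using L prob by (rule prob_space_L_ensemble_weights)
  have sub: "Pow T \<subseteq> Pow {..<n}"
    using T by auto
  have nonneg: "0 \<le> ?q Z" if "Z \<in> Pow T" for Z
    using that T by (intro prob_space_L_ensemble_weights(2)[OF L prob]) auto
  have "measure P {\<omega> \<in> space P. Y \<omega> \<subseteq> T} = measure P (Y -` Pow T \<inter> space P)"
    by (intro arg_cong[where f = "measure P"]) auto
  also have "\<dots> = measure (L_ensemble L) (Pow T)"
    using meas sub by (simp add: measure_distr distr[symmetric])
  also have "\<dots> = enn2real (ennreal (\<Sum>Z\<in>Pow T. ?q Z))"
    unfolding measure_def emeasure_L_ensemble[OF L sub] using nonneg by (subst sum_ennreal) auto
  also have "\<dots> = (\<Sum>Z\<in>Pow T. ?q Z)"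
    using nonneg by (intro enn2real_ennreal sum_nonneg)
  also have "\<dots> = principal_minor (L + 1\<^sub>m n) T / ?D"
    using principal_minor_add_one[OF L T] by (simp add: sum_divide_distrib)
  finally show "measure P {\<omega> \<in> space P. Y \<omega> \<subseteq> T} = principal_minor (L + 1\<^sub>m n) T / ?D" .
qed

section \<open>The complementary kernel and the law of the complement\<close>

lemma one_minus_marginal_kernel:
  assumes L: "L \<in> carrier_mat n n" and D: "Determinant.det (L + 1\<^sub>m n) \<noteq> 0"
  shows "marginal_kernel L \<in> carrier_mat n n"
    and "1\<^sub>m n - marginal_kernel L \<in> carrier_mat n n"
    and "(1\<^sub>m n - marginal_kernel L) * (L + 1\<^sub>m n) = 1\<^sub>m n"
proof -
  have LI: "L + 1\<^sub>m n \<in> carrier_mat n n"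
    using L by simp
  \<comment> \<open>A nonzero determinant rules out the result \<open>None\<close>, so
    \<open>the\<close> in \<open>marginal_kernel\<close> returns the actual inverse.\<close>
  obtain B where some: "mat_inverse (L + 1\<^sub>m n) = Some B"
    using mat_inverse(1)[OF LI] det_non_zero_imp_unit[OF LI D] by fastforce
  then have B: "(L + 1\<^sub>m n) * B = 1\<^sub>m n" "B * (L + 1\<^sub>m n) = 1\<^sub>m n" "B \<in> carrier_mat n n"
    using mat_inverse(2)[OF LI] by auto
  have K: "marginal_kernel L = L * B"
    using L some by (simp add: marginal_kernel_def)
  then show carr: "marginal_kernel L \<in> carrier_mat n n"
    using L B(3) by simp
  then show "1\<^sub>m n - marginal_kernel L \<in> carrier_mat n n"
    by (rule minus_carrier_mat)
  \<comment> \<open>This is \<open>(L + I) * B = I\<close> multiplied out; subtracting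
    \<open>L * B\<close> leaves \<open>I - K = B\<close>.\<close>
  have "L * B + B = 1\<^sub>m n"
    using B add_mult_distrib_mat[OF L one_carrier_mat B(3)] by simp
  then have "1\<^sub>m n - L * B = (L * B + B) - L * B"
    by simp
  also have "\<dots> = B"
    using L B(3) by (intro eq_matI) auto
  finally have "1\<^sub>m n - marginal_kernel L = B"
    by (simp add: K)
  then show "(1\<^sub>m n - marginal_kernel L) * (L + 1\<^sub>m n) = 1\<^sub>m n"
    using B(2) by simp
qed

lemma L_ensemble_complement_prob:
  assumes L: "L \<in> carrier_mat n n" and Y: "is_L_ensemble P Y L" and S: "S \<subseteq> {..<n}"
  shows "measure P {\<omega> \<in> space P. S \<subseteq> {..<n} - Y \<omega>}
    = principal_minor (1\<^sub>m n - marginal_kernel L) S"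
proof -
  let ?D = "Determinant.det (L + 1\<^sub>m n)"
  have D: "?D \<noteq> 0"
    using L Y S by (rule L_ensemble_subset_prob)
  \<comment> \<open>Both \<open>S\<close> and \<open>Y \<omega>\<close> lie in
    \<open>{..<n}\<close>, so avoiding \<open>S\<close> is the same as being contained in its
    complement.\<close>
  have "Y \<omega> \<subseteq> {..<n}" if "\<omega> \<in> space P" for \<omega>
    using L Y measurable_space[OF _ that, of Y "count_space (Pow {..<n})"]
    by (auto simp: is_L_ensemble_def random_subset_def)
  then have "{\<omega> \<in> space P. S \<subseteq> {..<n} - Y \<omega>} = {\<omega> \<in> space P. Y \<omega> \<subseteq> {..<n} - S}"
    using S by blast
  then have "measure P {\<omega> \<in> space P. S \<subseteq> {..<n} - Y \<omega>}
      = principal_minor (L + 1\<^sub>m n) ({..<n} - S) / ?D"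
    using L_ensemble_subset_prob(2)[OF L Y, of "{..<n} - S"] by simp
  also have "\<dots> = principal_minor (1\<^sub>m n - marginal_kernel L) S"
    using D jacobi_complementary_minor[OF _ one_minus_marginal_kernel(2,3)[OF L D] S] L
    by (simp add: field_simps)
  finally show ?thesis .
qed

lemma is_DPP_L_ensemble_complement:
  assumes L: "L \<in> carrier_mat n n" and Y: "is_L_ensemble P Y L"
  shows "is_DPP P (\<lambda>\<omega>. {..<n} - Y \<omega>) (1\<^sub>m n - marginal_kernel L)"
proof -
  \<comment> \<open>Any \<open>T\<close> gives this conclusion; the empty set is the simplest
    instance.\<close>
  have "Determinant.det (L + 1\<^sub>m n) \<noteq> 0"
    using L Y empty_subsetI by (rule L_ensemble_subset_prob)
  then have dim: "dim_row (marginal_kernel L) = n"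
    using one_minus_marginal_kernel(1)[OF L] by blast
  have P: "prob_space P" and meas: "Y \<in> measurable P (count_space (Pow {..<n}))"
    using L Y by (auto simp: is_L_ensemble_def random_subset_def)
  \<comment> \<open>The set of values of \<open>Y\<close> carries the discrete sigma-algebra, so
    taking complements is measurable.\<close>
  have "(\<lambda>\<omega>. {..<n} - Y \<omega>) \<in> measurable P (count_space (Pow {..<n}))"
    using meas by (rule measurable_compose) simp
  then show ?thesis
    using P L_ensemble_complement_prob[OF L Y] by (simp add: is_DPP_def random_subset_def dim)
qed

theorem corollary3:
  fixes A C W K :: "real mat" and n N :: nat
    and P :: "'w measure" and Y :: "'w \<Rightarrow> nat set"
  assumes A: "A \<in> carrier_mat n n"
    and C: "C = 1\<^sub>m n"
    and N: "N \<ge> 1"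
    and W: "W = obs_gramian A C N"
    and K: "K = marginal_kernel W"
    and Y: "is_L_ensemble P Y W"
  shows "is_DPP P (\<lambda>\<omega>. {..<n} - Y \<omega>) (1\<^sub>m n - K)
    \<and> (\<forall>S \<subseteq> {..<n}. measure P {\<omega> \<in> space P. S \<subseteq> {..<n} - Y \<omega>}
                      = principal_minor (1\<^sub>m n - K) S)
    \<and> (\<forall>i<n. (1\<^sub>m n - K) $$ (i, i) = 1 - K $$ (i, i)
             \<and> measure P {\<omega> \<in> space P. i \<notin> Y \<omega>} = (1\<^sub>m n - K) $$ (i, i))"
proof (intro conjI allI impI)
  have L: "W \<in> carrier_mat n n"
    using A by (simp add: W obs_gramian_def)
  have D: "Determinant.det (W + 1\<^sub>m n) \<noteq> 0"
    using L Y empty_subsetI by (rule L_ensemble_subset_prob)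
  have carr: "K \<in> carrier_mat n n" "1\<^sub>m n - K \<in> carrier_mat n n"
    unfolding K using one_minus_marginal_kernel(1,2)[OF L D] .
  show "is_DPP P (\<lambda>\<omega>. {..<n} - Y \<omega>) (1\<^sub>m n - K)"
    unfolding K using L Y by (rule is_DPP_L_ensemble_complement)
  have minors: "measure P {\<omega> \<in> space P. S \<subseteq> {..<n} - Y \<omega>} = principal_minor (1\<^sub>m n - K) S"
    if "S \<subseteq> {..<n}" for S
    unfolding K using L Y that by (rule L_ensemble_complement_prob)
  show "measure P {\<omega> \<in> space P. S \<subseteq> {..<n} - Y \<omega>} = principal_minor (1\<^sub>m n - K) S"
    if "S \<subseteq> {..<n}" for S
    using that by (rule minors)
  fix i assume i: "i < n"
  show "(1\<^sub>m n - K) $$ (i, i) = 1 - K $$ (i, i)"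
    using carr(1) i by simp
  \<comment> \<open>Excluding \<open>i\<close> means that the complement contains
    \<open>{i}\<close>, and the minor on a singleton is the diagonal entry.\<close>
  show "measure P {\<omega> \<in> space P. i \<notin> Y \<omega>} = (1\<^sub>m n - K) $$ (i, i)"
    using minors[of "{i}"] principal_minor_singleton[OF carr(2) i] i by simp
qed

end
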